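(* For every integer $n \ge 1$, $R(Q_2, Q_n) \le \frac{5}{3}n + 2$.
   Context: $Q_k$ denotes the Boolean lattice of dimension $k$: the family of all subsets of a $k$-element ground set (e.g. $[k]=\{1,\dots,k\}$), ordered by inclusion. A subposet $Q'$ of a poset $Q$ is a copy of a poset $P$ if there is a bijection $f$ from $P$ to $Q'$ such that $x \le y$ in $P$ if and only if $f(x) \le f(y)$ in $Q$. For posets $P, P'$, the poset Ramsey number $R(P,P')$ is the smallest integer $N$ such that for every coloring of the elements of $Q_N$ in red and blue, there is a copy of $P$ all of whose elements are red or a copy of $P'$ all of whose elements are blue. *)

theory Defs
  imports Complex_Main
begin

text \<open>A poset is represented by its carrier, a set \<open>P :: 'a::order set\<close>, ordered by the
  restriction of \<open>\<le>\<close>. On sets, \<open>\<le>\<close> is inclusion.\<close>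

definition boolean_lattice :: "nat \<Rightarrow> nat set set" where
  "boolean_lattice k = Pow {1..k}"

definition poset_copy :: "'a::order set \<Rightarrow> 'b::order set \<Rightarrow> bool" where
  "poset_copy P Q' \<longleftrightarrow>
     (\<exists>f. bij_betw f P Q' \<and> (\<forall>x\<in>P. \<forall>y\<in>P. x \<le> y \<longleftrightarrow> f x \<le> f y))"

datatype colour = Red | Blue

text \<open>Only the values of the colouring \<open>c\<close> on \<open>boolean_lattice N\<close> matter.\<close>

definition ramsey_property :: "'a::order set \<Rightarrow> 'b::order set \<Rightarrow> nat \<Rightarrow> bool" where
  "ramsey_property P P' N \<longleftrightarrow>
     (\<forall>c :: nat set \<Rightarrow> colour.
        (\<exists>S \<subseteq> boolean_lattice N. poset_copy P S \<and> (\<forall>x\<in>S. c x = Red)) \<or>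
        (\<exists>S \<subseteq> boolean_lattice N. poset_copy P' S \<and> (\<forall>x\<in>S. c x = Blue)))"

text \<open>If no \<open>N\<close> has the Ramsey property, this value is unspecified, so an upper bound on
  \<open>poset_ramsey P P'\<close> is provable only together with the existence of such an \<open>N\<close>.\<close>

definition poset_ramsey :: "'a::order set \<Rightarrow> 'b::order set \<Rightarrow> nat" where
  "poset_ramsey P P' = (LEAST N. ramsey_property P P' N)"

end

theory Submission
  imports Defs "HOL-Combinatorics.Multiset_Permutations"
begin

text \<open>
  Put \<open>k = 2 * n div 3 + 2\<close> and split the ground set of size \<open>n + k\<close> into \<open>X\<close> of size \<open>n\<close> and \<open>Y\<close> of
  size \<open>k\<close>. If there is no blue copy of \<open>Q\<^sub>n\<close>, then a greedy embedding argument gives, for each of the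
  \<open>k!\<close> orderings of \<open>Y\<close>, a red chain whose traces on \<open>Y\<close> are exactly the initial segments of that
  ordering. Its bottom lies above a minimal red \<open>A \<subseteq> X\<close>, and its top below a red \<open>B \<union> Y\<close> with \<open>B \<subseteq> X\<close>
  maximal. The candidates for \<open>A\<close> and for \<open>B\<close> are antichains, so two applications of the LYM
  inequality bound the number of pairs \<open>A \<subseteq> B\<close> by the largest trinomial coefficient \<open>n! / (a! b! c!)\<close>,
  which is less than \<open>k!\<close>. Hence two orderings share \<open>A\<close> and \<open>B\<close>; where they differ, their chains
  contain two incomparable red sets, which together with \<open>A\<close> and \<open>B \<union> Y\<close> form a red \<open>Q\<^sub>2\<close>.
\<close>

section \<open>The LYM inequality and its version for pairs\<close>

text \<open>Induction on \<open>card X\<close> by counting pairs \<open>x \<notin> A\<close>: an antichain not containing \<open>X\<close> restricts, for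
  each \<open>x\<close>, to an antichain in the subsets of \<open>X - {x}\<close>.\<close>
lemma lym_inequality:
  assumes "finite X" "F \<subseteq> Pow X" "\<And>A B. A \<in> F \<Longrightarrow> B \<in> F \<Longrightarrow> A \<subseteq> B \<Longrightarrow> A = B"
  shows "(\<Sum>A\<in>F. fact (card A) * fact (card X - card A)) \<le> (fact (card X) :: nat)"
  using assms
proof (induction "card X" arbitrary: X F)
  case 0
  then have "F \<subseteq> {{}}" by auto
  then have "F = {} \<or> F = {{}}" by blast
  with 0 show ?case by auto
next
  case (Suc m)
  note mX = Suc.hyps(2)[symmetric]
  show ?case
  proof (cases "X \<in> F")
    case True
    with Suc.prems have "F = {X}" by blast
    then show ?thesis by simp
  next
    case False
    have fin: "finite F" using Suc.prems(1,2) by (simp add: finite_subset)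
    have cX: "card (X - {x}) = m" if "x \<in> X" for x
      using that mX by simp
    have lt: "A \<subset> X" if "A \<in> F" for A using that Suc.prems(2) False by blast
    let ?w = "\<lambda>A. fact (card A) * fact (m - card A) :: nat"
    \<comment> \<open>As \<open>A \<noteq> X\<close>, the factorial of \<open>Suc m - card A\<close>
      splits off the factor \<open>card (X - A)\<close>, which counts the
      \<open>x \<notin> A\<close>.\<close>
    have "(\<Sum>A\<in>F. fact (card A) * fact (card X - card A)) = (\<Sum>A\<in>F. card (X - A) * ?w A)"
    proof (rule sum.cong)
      fix A assume "A \<in> F"
      then have A: "A \<subset> X" by (rule lt)
      then have "card A < Suc m" using Suc.prems(1) psubset_card_mono mX by metis
      moreover have "card (X - A) = Suc m - card A"
        using A Suc.prems(1) mX by (metis card_Diff_subset finite_subset psubset_imp_subset)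
      ultimately show "fact (card A) * fact (card X - card A) = card (X - A) * ?w A"
        by (simp add: mX Suc_diff_le algebra_simps)
    qed simp
    also have "\<dots> = (\<Sum>A\<in>F. \<Sum>x\<in>X. if x \<notin> A then ?w A else 0)"
    proof (rule sum.cong)
      fix A assume "A \<in> F"
      have "(\<Sum>x\<in>X. if x \<notin> A then ?w A else 0) = (\<Sum>x\<in>{x\<in>X. x \<notin> A}. ?w A)"
        by (rule sum.inter_filter[symmetric]) (rule Suc.prems(1))
      also have "{x\<in>X. x \<notin> A} = X - A" by auto
      finally show "card (X - A) * ?w A = (\<Sum>x\<in>X. if x \<notin> A then ?w A else 0)" by simp
    qed simp
    also have "\<dots> = (\<Sum>x\<in>X. \<Sum>A\<in>F. if x \<notin> A then ?w A else 0)"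
      by (rule sum.swap)
    also have "\<dots> = (\<Sum>x\<in>X. \<Sum>A\<in>{A\<in>F. x \<notin> A}. ?w A)"
      using fin by (simp only: sum.inter_filter)
    also have "\<dots> \<le> (\<Sum>x\<in>X. fact m)"
    proof (rule sum_mono)
      fix x assume x: "x \<in> X"
      have "(\<Sum>A\<in>{A\<in>F. x \<notin> A}. fact (card A) * fact (card (X - {x}) - card A))
          \<le> (fact (card (X - {x})) :: nat)"
      proof (rule Suc.hyps(1))
        show "{A \<in> F. x \<notin> A} \<subseteq> Pow (X - {x})" using Suc.prems(2) by blast
      qed (use Suc.prems(1,3) cX[OF x] in simp_all)
      then show "(\<Sum>A\<in>{A\<in>F. x \<notin> A}. ?w A) \<le> fact m" by (simp only: cX[OF x])
    qed
    also have "\<dots> = fact (card X)" by (simp add: mX)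
    finally show ?thesis .
  qed
qed

text \<open>For fixed \<open>A\<close>, the sets \<open>B - A\<close> form an antichain in the
  subsets of \<open>X - A\<close>, so LYM bounds the inner sum over \<open>B\<close> by the
  factorial of \<open>card X - card A\<close>. LYM for \<open>F\<close> then bounds the outer
  sum.\<close>

lemma lym_inequality_pairs:
  assumes X: "finite X" and FX: "F \<subseteq> Pow X" "G \<subseteq> Pow X"
    and F: "\<And>A B. A \<in> F \<Longrightarrow> B \<in> F \<Longrightarrow> A \<subseteq> B \<Longrightarrow> A = B"
    and G: "\<And>A B. A \<in> G \<Longrightarrow> B \<in> G \<Longrightarrow> A \<subseteq> B \<Longrightarrow> A = B"
  shows "(\<Sum>(A, B) \<in> Sigma F (\<lambda>A. {B \<in> G. A \<subseteq> B}).
      fact (card A) * fact (card B - card A) * fact (card X - card B)) \<le> (fact (card X) :: nat)"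
proof -
  have fin: "finite F" "finite G" using X FX by (simp_all add: finite_subset)
  have "(\<Sum>(A, B) \<in> Sigma F (\<lambda>A. {B \<in> G. A \<subseteq> B}).
      fact (card A) * fact (card B - card A) * fact (card X - card B) :: nat)
      = (\<Sum>A\<in>F. fact (card A) * (\<Sum>B\<in>{B \<in> G. A \<subseteq> B}. fact (card B - card A) * fact (card X - card B)))"
    using fin by (simp add: sum.Sigma[symmetric] sum_distrib_left mult.assoc)
  also have "\<dots> \<le> (\<Sum>A\<in>F. fact (card A) * fact (card X - card A))"
  proof (intro sum_mono mult_left_mono)
    fix A assume "A \<in> F"
    then have A: "A \<subseteq> X" using FX by blast
    then have "finite A" using X finite_subset by blast
    note A = \<open>A \<subseteq> X\<close> this
    let ?G = "{B \<in> G. A \<subseteq> B}"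
    have inj: "inj_on (\<lambda>B. B - A) ?G" by (auto simp: inj_on_def)
    have "(\<Sum>B\<in>?G. fact (card B - card A) * fact (card X - card B) :: nat)
        = (\<Sum>B\<in>?G. fact (card (B - A)) * fact (card (X - A) - card (B - A)))"
    proof (rule sum.cong)
      fix B assume "B \<in> ?G"
      then have "A \<subseteq> B" "B \<subseteq> X" using FX by auto
      then have "card A \<le> card B" "card B \<le> card X"
        using X by (auto intro: card_mono finite_subset)
      with A \<open>A \<subseteq> B\<close> show "fact (card B - card A) * fact (card X - card B)
        = (fact (card (B - A)) * fact (card (X - A) - card (B - A)) :: nat)"
        by (simp add: card_Diff_subset)
    qed simp
    also have "\<dots> = (\<Sum>C\<in>(\<lambda>B. B - A) ` ?G. fact (card C) * fact (card (X - A) - card C))"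
      by (simp add: sum.reindex[OF inj])
    also have "\<dots> \<le> fact (card (X - A))"
    proof (rule lym_inequality)
      show "(\<lambda>B. B - A) ` ?G \<subseteq> Pow (X - A)" using FX by auto
    next
      fix C D
      assume "C \<in> (\<lambda>B. B - A) ` ?G" "D \<in> (\<lambda>B. B - A) ` ?G" and sub: "C \<subseteq> D"
      then obtain B B' where "B \<in> ?G" "B' \<in> ?G" "C = B - A" "D = B' - A" by blast
      moreover from this sub have "B \<subseteq> B'" by blast
      ultimately show "C = D" using G[of B B'] by simp
    qed (use X in simp)
    also have "\<dots> = fact (card X - card A)" using A by (simp add: card_Diff_subset)
    finally show "(\<Sum>B\<in>?G. fact (card B - card A) * fact (card X - card B))
      \<le> (fact (card X - card A) :: nat)" .
  qed simp
  also have "\<dots> \<le> fact (card X)" by (rule lym_inequality[OF X FX(1) F])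
  finally show ?thesis .
qed

section \<open>Factorial estimates\<close>

text \<open>The tangent at \<open>q\<close> to the log-convex function \<open>a \<mapsto> a!\<close>, with the denominators cleared.\<close>
lemma fact_ge_tangent: "fact q * Suc q ^ a \<le> (fact a * Suc q ^ q :: nat)"
proof (cases "q \<le> a")
  case True
  \<comment> \<open>Each factor of the factorial beyond \<open>q\<close> is at least
    \<open>Suc q\<close>.\<close>
  have "fact q * Suc q ^ d \<le> (fact (q + d) :: nat)" for d
  proof (induction d)
    case (Suc d)
    have "Suc q * (fact q * Suc q ^ d) \<le> Suc (q + d) * (fact (q + d) :: nat)"
      by (rule mult_le_mono) (use Suc in auto)
    then show ?case by (simp add: mult_ac)
  qed simp
  from this[of "a - q"] have "fact q * Suc q ^ (a - q) * Suc q ^ q \<le> (fact a * Suc q ^ q :: nat)"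
    using True by simp
  then show ?thesis using True by (simp only: mult.assoc power_add[symmetric] le_add_diff_inverse2)
next
  case False
  \<comment> \<open>Conversely, each factor up to \<open>Suc q\<close> is at most
    \<open>Suc q\<close>.\<close>
  have "a + d \<le> Suc q \<Longrightarrow> fact (a + d) \<le> (fact a * Suc q ^ d :: nat)" for d
  proof (induction d)
    case (Suc d)
    then have "Suc (a + d) * fact (a + d) \<le> Suc q * (fact a * Suc q ^ d :: nat)"
      by (intro mult_le_mono) auto
    then show ?case by (simp add: mult_ac)
  qed simp
  from this[of "q - a"] have "fact q * Suc q ^ a \<le> (fact a * Suc q ^ (q - a) * Suc q ^ a :: nat)"
    using False by simp
  then show ?thesis using False by (simp only: mult.assoc power_add[symmetric] le_add_diff_inverse2)
qed

text \<open>The product of the three tangent bounds depends only on \<open>a + b + c\<close>. For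
  \<open>r < 3\<close> the left side is the value at the most balanced split, with \<open>r\<close>
  parts equal to \<open>Suc q\<close> and the others to \<open>q\<close>.\<close>

lemma fact_product_ge:
  assumes "a + b + c = 3 * q + r"
  shows "fact q ^ 3 * Suc q ^ r \<le> (fact a * fact b * fact c :: nat)"
proof -
  have "(fact q * Suc q ^ a) * (fact q * Suc q ^ b) * (fact q * Suc q ^ c)
      \<le> (fact a * Suc q ^ q) * (fact b * Suc q ^ q) * (fact c * Suc q ^ q :: nat)"
    by (intro mult_le_mono fact_ge_tangent)
  also have "(fact q * Suc q ^ a) * (fact q * Suc q ^ b) * (fact q * Suc q ^ c)
      = fact q ^ 3 * Suc q ^ (a + b + c)"
    by (simp only: power_add power3_eq_cube mult_ac)
  also have "\<dots> = fact q ^ 3 * Suc q ^ r * Suc q ^ (3 * q)"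
    by (simp only: assms power_add mult_ac)
  also have "(fact a * Suc q ^ q) * (fact b * Suc q ^ q) * (fact c * Suc q ^ q)
      = fact a * fact b * fact c * Suc q ^ (3 * q)"
    by (simp only: power_mult power3_eq_cube power_mult_distrib mult_ac mult.commute[of 3 q])
  finally show ?thesis by simp
qed

text \<open>This is the estimate for \<open>n = 3 * q + 1\<close>, where
  \<open>2 * n div 3 + 2 = 2 * q + 2\<close> and the balanced split is \<open>q\<close>,
  \<open>q\<close>, \<open>q + 1\<close>. The other residues modulo 3 are derived from it.\<close>

lemma fact_3n_plus_1_less: "fact (3 * q + 1) < (fact (2 * q + 2) * fact q ^ 3 * Suc q :: nat)"
proof (induction q)
  case (Suc q)
  define F :: nat where "F = fact (2 * q + 2) * fact q ^ 3 * Suc q"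
  have "(fact (3 * Suc q + 1) :: nat) = (3 * q + 4) * (3 * q + 3) * (3 * q + 2) * fact (3 * q + 1)"
  proof -
    have "3 * Suc q + 1 = Suc (Suc (Suc (3 * q + 1)))" by simp
    moreover have "Suc (3 * q + 1) = 3 * q + 2" "Suc (3 * q + 2) = 3 * q + 3" "Suc (3 * q + 3) = 3 * q + 4"
      by simp_all
    ultimately show ?thesis by (metis fact_Suc mult.assoc of_nat_id)
  qed
  also have "\<dots> < (3 * q + 4) * (3 * q + 3) * (3 * q + 2) * F"
    using Suc.IH unfolding F_def by (intro mult_strict_left_mono) auto
  \<comment> \<open>The factors are the growth of the two sides from \<open>q\<close> to
    \<open>Suc q\<close>. As polynomials they compare coefficient by coefficient, with equal
    constant terms 24.\<close>
  also have "\<dots> \<le> ((2 * q + 4) * (2 * q + 3) * (q + 1) ^ 2 * (q + 2)) * F"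
    by (intro mult_right_mono) (auto simp: algebra_simps power2_eq_square)
  also have "\<dots> = fact (2 * Suc q + 2) * fact (Suc q) ^ 3 * Suc (Suc q)"
  proof -
    have "fact (2 * Suc q + 2) = (2 * q + 4) * ((2 * q + 3) * fact (2 * q + 2) :: nat)"
      by (simp add: numeral_eq_Suc)
    moreover have "fact (Suc q) ^ 3 = (q + 1) ^ 3 * (fact q ^ 3 :: nat)"
      by (simp only: fact_Suc power_mult_distrib) simp
    ultimately show ?thesis
      unfolding F_def by (simp only: power2_eq_square power3_eq_cube mult_ac Suc_eq_plus1) simp
  qed
  finally show ?case .
qed simp

text \<open>This inequality dictates the size \<open>k = 2 * n div 3 + 2\<close> of
  \<open>Y\<close>: every trinomial coefficient of order \<open>n\<close> is less than
  \<open>k!\<close>.\<close>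

lemma fact_less_fact_product:
  assumes n: "a + b + c = n"
  shows "fact n < (fact (2 * n div 3 + 2) * (fact a * fact b * fact c) :: nat)"
proof -
  define q where "q = n div 3"
  define T :: nat where "T = fact (2 * q + 2) * fact q ^ 3"
  have base: "fact (3 * q + 1) < T * Suc q"
    using fact_3n_plus_1_less[of q] by (simp only: T_def)
  have "n mod 3 < 3" by simp
  then consider "n = 3 * q" | "n = 3 * q + 1" | "n = 3 * q + 2"
    unfolding q_def by linarith
  then show ?thesis
  proof cases
    case 1
    \<comment> \<open>The estimate for \<open>3 * q + 1\<close> is divided by
      \<open>3 * q + 1\<close>, which is at least \<open>Suc q\<close>.\<close>
    have "(3 * q + 1) * fact (3 * q) < (3 * q + 1) * T"
    proof -
      have "(3 * q + 1) * fact (3 * q) = fact (3 * q + 1)" by simp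
      also have "\<dots> < T * Suc q" by (rule base)
      also have "\<dots> \<le> (3 * q + 1) * T" by simp
      finally show ?thesis .
    qed
    then have "fact n < T" unfolding 1 by (simp only: mult_less_cancel1)
    also have "T \<le> fact (2 * q + 2) * (fact a * fact b * fact c)"
      unfolding T_def using fact_product_ge[of a b c q 0] n 1 by simp
    also have "2 * q + 2 = 2 * n div 3 + 2" using 1 by simp
    finally show ?thesis .
  next
    case 2
    then have "fact n < T * Suc q" using base by simp
    also have "\<dots> \<le> fact (2 * q + 2) * (fact a * fact b * fact c)"
      unfolding T_def using fact_product_ge[of a b c q 1] n 2 by (simp only: mult.assoc mult_le_mono2 power_one_right)
    also have "2 * q + 2 = 2 * n div 3 + 2" using 2 by simp
    finally show ?thesis .
  next
    case 3
    have "(fact n :: nat) = (3 * q + 2) * fact (3 * q + 1)" using 3 by simp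
    also have "\<dots> < (3 * q + 2) * (T * Suc q)"
      using base by (intro mult_strict_left_mono) auto
    \<comment> \<open>In this case \<open>2 * n div 3 + 2\<close> is \<open>2 * q + 3\<close>, and
      the balanced product gains a second \<open>Suc q\<close>; together they outweigh the new
      factor \<open>3 * q + 2\<close>.\<close>
    also have "\<dots> \<le> ((2 * q + 3) * Suc q) * (T * Suc q)"
      by (intro mult_right_mono) (auto simp: algebra_simps)
    also have "\<dots> = fact (2 * q + 3) * (fact q ^ 3 * Suc q ^ 2)"
    proof -
      have "fact (2 * q + 3) = (2 * q + 3) * (fact (2 * q + 2) :: nat)"
        by (simp add: numeral_eq_Suc)
      then show ?thesis unfolding T_def by (simp only: power2_eq_square mult_ac)
    qed
    also have "\<dots> \<le> fact (2 * q + 3) * (fact a * fact b * fact c)"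
      using fact_product_ge[of a b c q 2] n 3 by (intro mult_left_mono) auto
    also have "2 * q + 3 = 2 * n div 3 + 2" using 3 by simp
    finally show ?thesis .
  qed
qed

section \<open>Embeddings of \<open>Q\<^sub>2\<close> and \<open>Q\<^sub>n\<close>\<close>

text \<open>Incomparability of \<open>p\<close> and \<open>q\<close> forces all inclusions to be
  strict: for instance, \<open>p \<subseteq> a\<close> and \<open>a \<subseteq> q\<close> would give
  \<open>p \<subseteq> q\<close>.\<close>

lemma poset_copy_diamond:
  fixes a d p q :: "nat set"
  assumes "a \<subseteq> p" "a \<subseteq> q" "p \<subseteq> d" "q \<subseteq> d" "\<not> p \<subseteq> q" "\<not> q \<subseteq> p"
  shows "poset_copy (boolean_lattice 2) {a, p, q, d}"
proof -
  define f where "f S = (if S = {} then a else if S = {1} then p else if S = {2} then q else d)"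
    for S :: "nat set"
  have B: "boolean_lattice 2 = {{}, {1}, {2}, {1, 2}}"
    unfolding boolean_lattice_def by (auto simp: numeral_eq_Suc atLeastAtMostSuc_conv Pow_insert)
  have f: "f {} = a" "f {1} = p" "f {2} = q" "f {1, 2} = d"
    by (auto simp: f_def doubleton_eq_iff)
  have neq: "\<not> p \<subseteq> a" "\<not> q \<subseteq> a" "\<not> d \<subseteq> p" "\<not> d \<subseteq> q" "\<not> d \<subseteq> a" "a \<subseteq> d"
    using assms by blast+
  have order: "\<forall>x\<in>boolean_lattice 2. \<forall>y\<in>boolean_lattice 2. x \<le> y \<longleftrightarrow> f x \<le> f y"
    unfolding B using assms neq by (simp only: ball_simps f) auto
  have "bij_betw f (boolean_lattice 2) {a, p, q, d}"
    unfolding bij_betw_def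
  proof
    show "inj_on f (boolean_lattice 2)"
      using order by (intro inj_onI) (metis order_antisym order_refl)
    show "f ` boolean_lattice 2 = {a, p, q, d}"
      unfolding B by (simp only: image_insert image_empty f)
  qed
  with order show ?thesis unfolding poset_copy_def by blast
qed

text \<open>The sets \<open>f i \<union> Y i\<close> with \<open>i < m\<close> form the chain.\<close>
definition red_chain :: "(nat set \<Rightarrow> colour) \<Rightarrow> (nat \<Rightarrow> nat set) \<Rightarrow> nat set \<Rightarrow> nat \<Rightarrow> (nat \<Rightarrow> nat set) \<Rightarrow> bool"
  where "red_chain c Y S m f \<longleftrightarrow>
    (\<forall>i<m. f i \<subseteq> S \<and> c (f i \<union> Y i) = Red) \<and> (\<forall>i j. i \<le> j \<longrightarrow> j < m \<longrightarrow> f i \<subseteq> f j)"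

text \<open>Send \<open>S\<close> to \<open>S \<union> Y (h S)\<close>, where \<open>h S\<close> is the length of the longest red chain inside \<open>S\<close>. This set
  is blue, as otherwise it would prolong the chain.\<close>
lemma blue_copy_or_red_chain:
  assumes Y: "\<And>i j. i \<le> j \<Longrightarrow> Y i \<subseteq> Y j" and disj: "\<And>i. X \<inter> Y i = {}"
    and no_chain: "\<nexists>f. red_chain c Y X (Suc k) f"
  shows "\<exists>g. (\<forall>S\<subseteq>X. g S \<subseteq> X \<union> Y k \<and> c (g S) = Blue) \<and> (\<forall>S\<subseteq>X. \<forall>T\<subseteq>X. S \<subseteq> T \<longleftrightarrow> g S \<subseteq> g T)"
proof -
  define h where "h S = (GREATEST m. \<exists>f. red_chain c Y S m f)" for S
  have mono: "red_chain c Y T m f" if "red_chain c Y S m f" "S \<subseteq> T" for S T m f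
    using that unfolding red_chain_def by blast
  \<comment> \<open>The bound makes \<open>GREATEST\<close> in \<open>h\<close> a true maximum; the
    empty chain, of length 0, shows that some length occurs.\<close>
  have bound: "m \<le> k" if "red_chain c Y S m f" "S \<subseteq> X" for S m f
  proof (rule ccontr)
    assume "\<not> m \<le> k"
    then have "red_chain c Y X (Suc k) f" using mono[OF that] unfolding red_chain_def by simp
    with no_chain show False by blast
  qed
  have h: "\<exists>f. red_chain c Y S (h S) f" if "S \<subseteq> X" for S
    unfolding h_def
  proof (rule GreatestI_ex_nat)
    have "red_chain c Y S 0 f" for f unfolding red_chain_def by simp
    then show "\<exists>m f. red_chain c Y S m f" by blast
  qed (use bound that in blast)
  have le_h: "m \<le> h S" if "red_chain c Y S m f" "S \<subseteq> X" for S m f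
    unfolding h_def by (rule Greatest_le_nat[of _ _ k]) (use that bound in blast)+
  have blue: "c (S \<union> Y (h S)) = Blue" if S: "S \<subseteq> X" for S
  proof (rule ccontr)
    assume "c (S \<union> Y (h S)) \<noteq> Blue"
    then have red: "c (S \<union> Y (h S)) = Red" by (cases "c (S \<union> Y (h S))") auto
    obtain f where "red_chain c Y S (h S) f" using h S by blast
    \<comment> \<open>Positions start at 0, so \<open>h S\<close> is the first free one, and
      \<open>S\<close> contains all earlier \<open>f i\<close>.\<close>
    with red have "red_chain c Y S (Suc (h S)) (f(h S := S))"
      unfolding red_chain_def by (auto simp: less_Suc_eq)
    from le_h[OF this S] show False by simp
  qed
  have h_mono: "h S \<le> h T" if "S \<subseteq> T" "T \<subseteq> X" for S T
    using h[of S] le_h mono that by (meson order_trans)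
  have h_le: "h S \<le> k" if "S \<subseteq> X" for S using h[OF that] bound that by blast
  show ?thesis
  proof (rule exI[of _ "\<lambda>S. S \<union> Y (h S)"], intro conjI allI impI)
    fix S T assume S: "S \<subseteq> X" and T: "T \<subseteq> X"
    show "S \<subseteq> T \<longleftrightarrow> S \<union> Y (h S) \<subseteq> T \<union> Y (h T)"
    proof
      assume "S \<subseteq> T"
      with Y[OF h_mono] T show "S \<union> Y (h S) \<subseteq> T \<union> Y (h T)" by blast
    next
      assume "S \<union> Y (h S) \<subseteq> T \<union> Y (h T)"
      with disj[of "h T"] S show "S \<subseteq> T" by blast
    qed
  qed (use blue Y[OF h_le] in blast)+
qed

section \<open>Orderings of \<open>Y\<close> and the pigeonhole argument\<close>

text \<open>Consecutive prefix sets differ in exactly one entry, so the prefix sets determine the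
  ordering.\<close>

lemma permutations_differ_in_prefix:
  assumes xs: "xs \<in> permutations_of_set A" and ys: "ys \<in> permutations_of_set A" and "xs \<noteq> ys"
  obtains i where "i \<le> card A" "set (take i xs) \<noteq> set (take i ys)"
proof (rule ccontr)
  assume "\<not> thesis"
  with that have eq: "set (take i xs) = set (take i ys)" if "i \<le> card A" for i using that by blast
  note p = permutations_of_setD[OF xs] permutations_of_setD[OF ys]
  have len: "length xs = card A" "length ys = card A"
    using p distinct_card by metis+
  have new: "set (take (Suc i) zs) - set (take i zs) = {zs ! i}"
    if "distinct zs" "i < length zs" for i and zs :: "'a list"
  proof -
    have "take (Suc i) zs = take i zs @ [zs ! i]" using that by (simp add: take_Suc_conv_app_nth)
    moreover have "distinct (take (Suc i) zs)" using that by simp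
    ultimately show ?thesis by auto
  qed
  have "xs ! i = ys ! i" if "i < length xs" for i
    using new[of xs i] new[of ys i] eq[of i] eq[of "Suc i"] that p len by simp
  with len \<open>xs \<noteq> ys\<close> show False by (metis nth_equalityI)
qed

lemma ramsey_property_Q2:
  "ramsey_property (boolean_lattice 2) (boolean_lattice n) (n + (2 * n div 3 + 2))"
  unfolding ramsey_property_def
proof (rule allI, rule disjCI)
  fix c :: "nat set \<Rightarrow> colour"
  define k where "k = 2 * n div 3 + 2"
  define X where "X = {1..n}"
  define Y where "Y = {n + 1..n + k}"
  \<comment> \<open>For an ordering \<open>ys\<close> of \<open>Y\<close> these sets run from
    \<open>Z ys 0 = {}\<close> to \<open>Z ys k = Y\<close>, so a chain through all of them has
    \<open>Suc k\<close> members.\<close>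
  define Z where "Z ys i = set (take i ys)" for ys :: "nat list" and i
  let ?P = "permutations_of_set Y"
  assume no_blue: "\<not> (\<exists>S\<subseteq>boolean_lattice (n + (2 * n div 3 + 2)).
    poset_copy (boolean_lattice n) S \<and> (\<forall>x\<in>S. c x = Blue))"
  have cX: "finite X" "card X = n" and cY: "finite Y" "card Y = k"
    by (auto simp: X_def Y_def)
  have sub: "S \<in> boolean_lattice (n + k)" if "S \<subseteq> X \<union> Y" for S
    using that unfolding boolean_lattice_def X_def Y_def by fastforce
  have Z: "Z ys i \<subseteq> Z ys j" if "i \<le> j" for ys i j
    unfolding Z_def using that by (rule set_take_subset_set_take)
  have ZY: "Z ys i \<subseteq> Y" if "ys \<in> ?P" for ys i
    using permutations_of_setD(1)[OF that] set_take_subset[of i ys] by (simp add: Z_def)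
  have length: "length ys = k" if "ys \<in> ?P" for ys
    using permutations_of_setD[OF that] cY distinct_card by metis
  have Zk: "Z ys k = Y" if "ys \<in> ?P" for ys
    using permutations_of_setD(1)[OF that] length[OF that] by (simp add: Z_def)
  have chain: "\<exists>f. red_chain c (Z ys) X (Suc k) f" if ys: "ys \<in> ?P" for ys
  proof (rule ccontr)
    assume "\<nexists>f. red_chain c (Z ys) X (Suc k) f"
    moreover have "X \<inter> Z ys i = {}" for i using ZY[OF ys, of i] by (auto simp: X_def Y_def)
    ultimately obtain g where g: "\<And>S. S \<subseteq> X \<Longrightarrow> g S \<subseteq> X \<union> Z ys k \<and> c (g S) = Blue"
      and order: "\<And>S T. S \<subseteq> X \<Longrightarrow> T \<subseteq> X \<Longrightarrow> S \<subseteq> T \<longleftrightarrow> g S \<subseteq> g T"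
      using blue_copy_or_red_chain[of "Z ys" X c k] Z by metis
    have "inj_on g (Pow X)" using order by (intro inj_onI) (metis PowD order_antisym order_refl)
    then have "poset_copy (boolean_lattice n) (g ` Pow X)"
      unfolding poset_copy_def boolean_lattice_def X_def[symmetric]
      using order by (intro exI[of _ g]) (simp add: bij_betw_def)
    moreover have "g ` Pow X \<subseteq> boolean_lattice (n + k)" using g sub Zk[OF ys] by blast
    ultimately show False using no_blue g unfolding k_def by blast
  qed
  \<comment> \<open>Minimality here and maximality in \<open>G\<close> make both families
    antichains.\<close>
  define F where "F = {A. A \<subseteq> X \<and> c A = Red \<and> (\<forall>B. B \<subseteq> X \<longrightarrow> c B = Red \<longrightarrow> B \<subseteq> A \<longrightarrow> A = B)}"
  define G where "G = {A. A \<subseteq> X \<and> c (A \<union> Y) = Red \<and> (\<forall>B. B \<subseteq> X \<longrightarrow> c (B \<union> Y) = Red \<longrightarrow> A \<subseteq> B \<longrightarrow> A = B)}"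
  define W where "W = Sigma F (\<lambda>A. {B \<in> G. A \<subseteq> B})"
  define good where "good ys w f \<longleftrightarrow> red_chain c (Z ys) X (Suc k) f \<and> w \<in> W \<and> fst w \<subseteq> f 0 \<and> f k \<subseteq> snd w"
    for ys w f
  have "\<exists>w f. good ys w f" if ys: "ys \<in> ?P" for ys
  proof -
    obtain f where f: "red_chain c (Z ys) X (Suc k) f" using chain ys by blast
    then have f0: "f 0 \<subseteq> X" "c (f 0) = Red" and fk: "f k \<subseteq> X" "c (f k \<union> Y) = Red" and "f 0 \<subseteq> f k"
      using Zk[OF ys] unfolding red_chain_def by (force simp: Z_def)+
    have "finite {A. A \<subseteq> X \<and> c A = Red}" "f 0 \<in> {A. A \<subseteq> X \<and> c A = Red}"
      using cX f0 by auto
    then obtain A where A: "A \<subseteq> X" "c A = Red" "A \<subseteq> f 0"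
        "\<And>B. B \<subseteq> X \<Longrightarrow> c B = Red \<Longrightarrow> B \<subseteq> A \<Longrightarrow> A = B"
      by (auto dest: finite_has_minimal2)
    have "finite {A. A \<subseteq> X \<and> c (A \<union> Y) = Red}" "f k \<in> {A. A \<subseteq> X \<and> c (A \<union> Y) = Red}"
      using cX fk by auto
    then obtain B where B: "B \<subseteq> X" "c (B \<union> Y) = Red" "f k \<subseteq> B"
        "\<And>C. C \<subseteq> X \<Longrightarrow> c (C \<union> Y) = Red \<Longrightarrow> B \<subseteq> C \<Longrightarrow> B = C"
      by (auto dest: finite_has_maximal2)
    have "A \<in> F" "B \<in> G" using A B unfolding F_def G_def by blast+
    with A(3) B(3) f \<open>f 0 \<subseteq> f k\<close> have "good ys (A, B) f" unfolding good_def W_def by auto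
    then show ?thesis by blast
  qed
  then obtain w f where wf: "\<And>ys. ys \<in> ?P \<Longrightarrow> good ys (w ys) (f ys)" by metis
  have finW: "finite W"
    using cX unfolding W_def F_def G_def by (intro finite_SigmaI) auto
  have cardW: "card W < fact k"
  proof (cases "W = {}")
    case False
    let ?v = "\<lambda>(A, B). fact (card A) * fact (card B - card A) * fact (card X - card B) :: nat"
    \<comment> \<open>Every weight satisfies \<open>fact n < fact k * ?v p\<close>, while by LYM the
      weights sum to at most \<open>fact n\<close>.\<close>
    have "card W * fact n = (\<Sum>p\<in>W. fact n)" by simp
    also have "\<dots> < (\<Sum>p\<in>W. fact k * ?v p)"
    proof (rule sum_strict_mono)
      fix p assume "p \<in> W"
      then obtain A B where p: "p = (A, B)" "A \<subseteq> B" "B \<subseteq> X" unfolding W_def G_def by auto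
      then have "card A \<le> card B" "card B \<le> n"
        using cX by (auto intro: card_mono finite_subset)
      then show "fact n < fact k * ?v p"
        using fact_less_fact_product[of "card A" "card B - card A" "n - card B" n]
        by (simp add: p k_def cX)
    qed (use False finW in auto)
    also have "\<dots> = fact k * (\<Sum>p\<in>W. ?v p)" by (simp add: sum_distrib_left)
    also have "\<dots> \<le> fact k * fact n"
      unfolding cX(2)[symmetric] W_def
      by (intro mult_left_mono lym_inequality_pairs) (auto simp: cX F_def G_def)
    finally show ?thesis by simp
  qed simp
  have "\<not> inj_on w ?P"
  proof
    assume "inj_on w ?P"
    moreover have "w ` ?P \<subseteq> W" using wf unfolding good_def by blast
    ultimately have "card ?P \<le> card W" using finW by (rule card_inj_on_le)
    with cardW cY show False by simp
  qed
  then obtain xs ys where xs: "xs \<in> ?P" and ys: "ys \<in> ?P" and "xs \<noteq> ys" and w: "w xs = w ys"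
    unfolding inj_on_def by blast
  then obtain i where i: "i \<le> k" and neq: "Z xs i \<noteq> Z ys i"
    using permutations_differ_in_prefix[OF xs ys] cY unfolding Z_def by metis
  obtain A B where AB: "w ys = (A, B)" by (cases "w ys")
  define p where "p = f xs i \<union> Z xs i"
  define q where "q = f ys i \<union> Z ys i"
  have elem: "A \<subseteq> f zs i \<union> Z zs i \<and> f zs i \<union> Z zs i \<subseteq> B \<union> Y \<and> f zs i \<subseteq> X \<and> c (f zs i \<union> Z zs i) = Red"
    if zs: "zs \<in> ?P" and wz: "w zs = (A, B)" for zs
  proof -
    have "A \<subseteq> f zs 0" "f zs k \<subseteq> B" "red_chain c (Z zs) X (Suc k) (f zs)"
      using wf[OF zs] wz unfolding good_def by auto
    moreover from this(3) i have "f zs 0 \<subseteq> f zs i" "f zs i \<subseteq> f zs k" "f zs i \<subseteq> X"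
        "c (f zs i \<union> Z zs i) = Red"
      unfolding red_chain_def by auto
    ultimately show ?thesis using ZY[OF zs, of i] by blast
  qed
  note ex = elem[OF xs w[unfolded AB], folded p_def] and ey = elem[OF ys AB, folded q_def]
  have AB': "A \<subseteq> X" "B \<subseteq> X" "c A = Red" "c (B \<union> Y) = Red"
    using wf[OF ys] AB unfolding good_def W_def F_def G_def by auto
  have card: "card (Z zs i) = i" "finite (Z zs i)" if "zs \<in> ?P" for zs
    using permutations_of_setD[OF that] length[OF that] i
    by (simp_all add: Z_def distinct_card)
  have XY: "X \<inter> Y = {}" by (auto simp: X_def Y_def)
  have "p \<inter> Y = Z xs i" "q \<inter> Y = Z ys i"
    using ex ey ZY[OF xs, of i] ZY[OF ys, of i] XY unfolding p_def q_def by blast+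
  \<comment> \<open>The traces on \<open>Y\<close> differ but both have \<open>i\<close> elements,
    so neither contains the other.\<close>
  then have "\<not> p \<subseteq> q" "\<not> q \<subseteq> p"
    using neq card[OF xs] card[OF ys] card_subset_eq by (metis inf_mono order_refl)+
  then have "poset_copy (boolean_lattice 2) {A, p, q, B \<union> Y}"
    using ex ey by (intro poset_copy_diamond) auto
  moreover have "{A, p, q, B \<union> Y} \<subseteq> boolean_lattice (n + k)"
    using ex ey AB' by (auto intro!: sub)
  ultimately show "\<exists>S\<subseteq>boolean_lattice (n + (2 * n div 3 + 2)).
      poset_copy (boolean_lattice 2) S \<and> (\<forall>x\<in>S. c x = Red)"
    using ex ey AB' unfolding k_def[symmetric] by (intro exI[of _ "{A, p, q, B \<union> Y}"]) auto
qed

theorem theorem4: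
  fixes n :: nat
  assumes "n \<ge> 1"
  shows "real (poset_ramsey (boolean_lattice 2) (boolean_lattice n)) \<le> 5 / 3 * real n + 2"
proof -
  have "poset_ramsey (boolean_lattice 2) (boolean_lattice n) \<le> n + (2 * n div 3 + 2)"
    unfolding poset_ramsey_def by (rule Least_le) (rule ramsey_property_Q2)
  moreover have "real (2 * n div 3) \<le> 2 * real n / 3"
    using of_nat_mono[OF div_times_less_eq_dividend[of "2 * n" 3], where 'a = real] by simp
  ultimately show ?thesis by linarith
qed

end
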